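(* Let $\mathcal T$ be any integer topograph of discriminant $D<0$. Then $$|D|^{3/2}\sum_{v}\frac{1}{|rst|}=4\pi,\qquad |D|^{5/2}\sum_{v}\frac{|r+s+t|}{|rst|^2}=24\pi,$$ where both sums run over all vertices $v$ of $\mathcal T$ (each vertex contributing one term) and $r,s,t$ denote the labels of the three regions meeting at $v$.
   Context: A topograph is a tree drawn in the plane with all vertices of degree 3 whose regions are labelled by integers such that for every edge, if $s,t$ label the regions on either side of it and $r,u$ the other regions at its two endpoints, then $r+u=2(s+t)$; the edge directed from the $r$-end to the $u$-end gets label $s+t-r$. A configuration $[a,b,c]$ is a directed edge with label $b$, region $a$ on its left and $c$ on its right; $b^2-4ac$ is the same for all configurations and is the discriminant $D$ of the topograph (equivalently $D=r^2+s^2+t^2-2rs-2rt-2st$ for the labels $r,s,t$ at any vertex). For $D<0$ all region labels are nonzero and of one sign. *)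

theory Defs
  imports
    "HOL-Analysis.Analysis"
    "HOL-Combinatorics.Orbits"
    "Graph_Theory.Bidirected_Digraph"
    "Graph_Theory.Digraph_Component"
begin

text \<open>
  A tree drawn in the plane is encoded by its rotation system. Every edge is a pair of opposite
  arcs \<open>a\<close>, \<open>arev a\<close>, and \<open>rot a\<close> is the arc that follows \<open>a\<close> counterclockwise among the arcs
  leaving \<open>tail G a\<close>.

  The predicate \<open>tree\<close> of the graph library never holds for a bidirected graph with an edge,
  because \<open>[a, arev a]\<close> counts there as a cycle. Here these are the only cycles allowed, which also
  excludes loops and multiple edges. The library's \<open>connected\<close> includes nonemptiness.
\<close>

locale plane_cubic_tree = bidirected_digraph G arev
  for G :: "('v, 'e) pre_digraph" and arev :: "'e \<Rightarrow> 'e" +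
  fixes rot :: "'e \<Rightarrow> 'e"
  assumes connected: "connected G"
    and acyclic: "\<And>p. cycle p \<Longrightarrow> \<exists>a. p = [a, arev a]"
    and cubic: "\<And>v. v \<in> verts G \<Longrightarrow> out_degree G v = 3"
    and rot_permutes: "rot permutes arcs G"
    and rot_cyclic: "\<And>v. v \<in> verts G \<Longrightarrow> cyclic_on rot (out_arcs G v)"

text \<open>
  Walking along \<open>a\<close> and keeping the region on its left, one continues at \<open>head G a\<close> with
  the clockwise successor of \<open>arev a\<close>. A region is identified with its boundary, that is with the
  set of all arcs that have it on their left. The orbit is two-sided since the boundaries are
  infinite; the library's \<open>orbit\<close> only contains forward iterates.
\<close>

definition next_on_boundary :: "('e \<Rightarrow> 'e) \<Rightarrow> ('e \<Rightarrow> 'e) \<Rightarrow> 'e \<Rightarrow> 'e" where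
  "next_on_boundary arev rot = inv rot \<circ> arev"

definition left_region :: "('e \<Rightarrow> 'e) \<Rightarrow> ('e \<Rightarrow> 'e) \<Rightarrow> 'e \<Rightarrow> 'e set" where
  "left_region arev rot a =
     {b. \<exists>n. (next_on_boundary arev rot ^^ n) a = b \<or> (next_on_boundary arev rot ^^ n) b = a}"

definition right_region :: "('e \<Rightarrow> 'e) \<Rightarrow> ('e \<Rightarrow> 'e) \<Rightarrow> 'e \<Rightarrow> 'e set" where
  "right_region arev rot a = left_region arev rot (arev a)"

text \<open>
  The third region at \<open>tail G a\<close>, besides those to the left and right of \<open>a\<close>, lies to the left of
  \<open>rot a\<close>: the left region of an arc occupies the corner between it and its counterclockwise
  successor.
\<close>

definition tail_region :: "('e \<Rightarrow> 'e) \<Rightarrow> ('e \<Rightarrow> 'e) \<Rightarrow> 'e \<Rightarrow> 'e set" where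
  "tail_region arev rot a = left_region arev rot (rot a)"

definition head_region :: "('e \<Rightarrow> 'e) \<Rightarrow> ('e \<Rightarrow> 'e) \<Rightarrow> 'e \<Rightarrow> 'e set" where
  "head_region arev rot a = tail_region arev rot (arev a)"

text \<open>Only the values of \<open>lab\<close> on regions, i.e. on sets \<open>left_region arev rot a\<close> with
  \<open>a \<in> arcs G\<close>, are relevant.\<close>

locale topograph = plane_cubic_tree G arev rot
  for G :: "('v, 'e) pre_digraph" and arev :: "'e \<Rightarrow> 'e" and rot :: "'e \<Rightarrow> 'e" +
  fixes lab :: "'e set \<Rightarrow> int"
  assumes edge_law: "\<And>a. a \<in> arcs G \<Longrightarrow>
    lab (tail_region arev rot a) + lab (head_region arev rot a)
      = 2 * (lab (left_region arev rot a) + lab (right_region arev rot a))"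

definition edge_label :: "('e \<Rightarrow> 'e) \<Rightarrow> ('e \<Rightarrow> 'e) \<Rightarrow> ('e set \<Rightarrow> int) \<Rightarrow> 'e \<Rightarrow> int" where
  "edge_label arev rot lab a =
     lab (left_region arev rot a) + lab (right_region arev rot a) - lab (tail_region arev rot a)"

definition configuration ::
    "('e \<Rightarrow> 'e) \<Rightarrow> ('e \<Rightarrow> 'e) \<Rightarrow> ('e set \<Rightarrow> int) \<Rightarrow> 'e \<Rightarrow> int \<times> int \<times> int" where
  "configuration arev rot lab a =
     (lab (left_region arev rot a), edge_label arev rot lab a, lab (right_region arev rot a))"

definition has_discriminant ::
    "('v, 'e) pre_digraph \<Rightarrow> ('e \<Rightarrow> 'e) \<Rightarrow> ('e \<Rightarrow> 'e) \<Rightarrow> ('e set \<Rightarrow> int) \<Rightarrow> int \<Rightarrow> bool" where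
  "has_discriminant G arev rot lab D \<longleftrightarrow>
     (\<forall>e\<in>arcs G. case configuration arev rot lab e of (a, b, c) \<Rightarrow> b\<^sup>2 - 4 * a * c = D)"

text \<open>
  The regions meeting at a vertex \<open>v\<close> are those to the left of the three arcs leaving \<open>v\<close>, one for
  each corner at \<open>v\<close>.
\<close>

definition vertex_prod ::
    "('v, 'e) pre_digraph \<Rightarrow> ('e \<Rightarrow> 'e) \<Rightarrow> ('e \<Rightarrow> 'e) \<Rightarrow> ('e set \<Rightarrow> int) \<Rightarrow> 'v \<Rightarrow> int" where
  "vertex_prod G arev rot lab v = (\<Prod>a\<in>out_arcs G v. lab (left_region arev rot a))"

definition vertex_sum ::
    "('v, 'e) pre_digraph \<Rightarrow> ('e \<Rightarrow> 'e) \<Rightarrow> ('e \<Rightarrow> 'e) \<Rightarrow> ('e set \<Rightarrow> int) \<Rightarrow> 'v \<Rightarrow> int" where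
  "vertex_sum G arev rot lab v = (\<Sum>a\<in>out_arcs G v. lab (left_region arev rot a))"

end

theory Submission
  imports Defs
begin

text \<open>
  Write \<open>[a, b, c]\<close> for the configuration of an arc. At a vertex with labels \<open>r, s, t\<close> the three
  outgoing values of \<open>b / (a c)\<close> add up to \<open>\<bar>D\<bar> / (r s t)\<close>, and reversing an arc changes the sign.
  Hence summing over the vertices of a ball leaves only the arcs that leave the ball. With
  \<open>\<theta> = arctan (sqrt \<bar>D\<bar> / b)\<close> one has \<open>sqrt \<bar>D\<bar> b / (a c) = 2 sin (2 \<theta>)\<close>, and \<open>\<theta>\<close> is an angle of the
  triangle with side lengths \<open>sqrt r, sqrt s, sqrt t\<close>, so it telescopes as well: the angles of the
  arcs leaving a ball always have sum \<open>\<pi>\<close>. If the centre of the ball minimises \<open>r + s + t\<close>, then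
  \<open>b\<close> grows at least linearly with the radius, so that \<open>\<theta> \<rightarrow> 0\<close> uniformly and the sum of
  \<open>2 sin (2 \<theta>)\<close> tends to \<open>4 \<pi>\<close>. For the second series the same argument applies to
  \<open>b / (a c)\<^sup>2\<close>, whose sum at a vertex is \<open>\<bar>D\<bar> (r + s + t) / (r s t)\<^sup>2 - 6 / (r s t)\<close>; here the
  contribution of the arcs leaving the ball tends to \<open>0\<close>.
\<close>

section \<open>Analytic preliminaries\<close>

text \<open>The second hypothesis solved for \<open>z\<close> gives (1 - x y) / (x + y), the
  cotangent of \<open>arctan x + arctan y\<close>. Since x + y > 0 puts this sum strictly between 0
  and pi, its complement to pi / 2 lies on the principal branch. Cotangents of the angles of a
  triangle satisfy this relation.\<close>

lemma arctan_sum_pi_half: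
  assumes "x + y > 0" and "x * y + x * z + y * z = 1"
  shows "arctan x + arctan y + arctan z = pi / 2"
proof -
  have "arctan (- x) < arctan y"
    using assms(1) by (subst arctan_less_iff) simp
  then have "arctan x + arctan y > 0"
    by (simp add: arctan_minus)
  moreover have "arctan x + arctan y < pi"
    using arctan_ubound[of x] arctan_ubound[of y] by simp
  ultimately have range: "- (pi / 2) < pi / 2 - (arctan x + arctan y)"
      "pi / 2 - (arctan x + arctan y) < pi / 2"
    by auto
  define c where "c = cos (arctan x) * cos (arctan y)"
  have c: "c > 0"
    by (simp add: c_def cos_arctan add_pos_nonneg)
  have sin: "sin (arctan w) = w * cos (arctan w)" for w
    by (simp add: sin_arctan cos_arctan)
  have "cos (arctan x + arctan y) = c * (1 - x * y)" "sin (arctan x + arctan y) = c * (x + y)"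
    unfolding cos_add sin_add sin c_def by (simp_all add: algebra_simps)
  then have "tan (pi / 2 - (arctan x + arctan y)) = (c * (1 - x * y)) / (c * (x + y))"
    unfolding tan_def sin_diff cos_diff by simp
  also have "\<dots> = (1 - x * y) / (x + y)"
    using c by simp
  also have "\<dots> = z"
    using assms by (simp add: field_simps)
  finally have "arctan z = pi / 2 - (arctan x + arctan y)"
    using range by (intro arctan_unique)
  then show ?thesis
    by simp
qed

text \<open>Over the common denominator r s t the numerators add up to the Heron polynomial, which
  equals |D| for the labels at a vertex.\<close>

lemma flux_identity:
  fixes r s t :: real
  assumes "r > 0" "s > 0" "t > 0"
  shows "(r + t - s) / (r * t) + ((s + r - t) / (s * r) + (t + s - r) / (t * s)) =
    (2 * r * s + 2 * r * t + 2 * s * t - r\<^sup>2 - s\<^sup>2 - t\<^sup>2) * (1 / (r * s * t))"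
proof -
  have eqs: "(r + t - s) / (r * t) = s * (r + t - s) / (r * s * t)"
    "(s + r - t) / (s * r) = t * (s + r - t) / (r * s * t)"
    "(t + s - r) / (t * s) = r * (t + s - r) / (r * s * t)"
    using assms by (simp_all add: frac_eq_eq)
  have num: "s * (r + t - s) + (t * (s + r - t) + r * (t + s - r)) =
      2 * r * s + 2 * r * t + 2 * s * t - r\<^sup>2 - s\<^sup>2 - t\<^sup>2"
    by (simp add: power2_eq_square algebra_simps)
  show ?thesis
    by (simp only: eqs num times_divide_eq_right mult_1_right flip: add_divide_distrib)
qed

text \<open>Over the common denominator (r s t)^2 the numerator on the left has no r s t term, while
  the Heron polynomial times r + s + t contains 6 r s t; this is the origin of the 6.\<close>

lemma flux_sq_identity:
  fixes r s t :: real
  assumes "r > 0" "s > 0" "t > 0"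
  shows "(r + t - s) / (r * t)\<^sup>2 + ((s + r - t) / (s * r)\<^sup>2 + (t + s - r) / (t * s)\<^sup>2) =
    (2 * r * s + 2 * r * t + 2 * s * t - r\<^sup>2 - s\<^sup>2 - t\<^sup>2) * ((r + s + t) / (r * s * t)\<^sup>2)
      - 6 * (1 / (r * s * t))"
proof -
  have eqs: "(r + t - s) / (r * t)\<^sup>2 = s\<^sup>2 * (r + t - s) / (r * s * t)\<^sup>2"
    "(s + r - t) / (s * r)\<^sup>2 = t\<^sup>2 * (s + r - t) / (r * s * t)\<^sup>2"
    "(t + s - r) / (t * s)\<^sup>2 = r\<^sup>2 * (t + s - r) / (r * s * t)\<^sup>2"
    "6 * 1 / (r * s * t) = 6 * (r * s * t) / (r * s * t)\<^sup>2"
    using assms by (simp_all add: frac_eq_eq power_mult_distrib) (simp add: power2_eq_square)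
  have num: "s\<^sup>2 * (r + t - s) + (t\<^sup>2 * (s + r - t) + r\<^sup>2 * (t + s - r)) =
      (2 * r * s + 2 * r * t + 2 * s * t - r\<^sup>2 - s\<^sup>2 - t\<^sup>2) * (r + s + t) - 6 * (r * s * t)"
    by (simp add: power2_eq_square algebra_simps)
  show ?thesis
    by (simp only: eqs num times_divide_eq_right flip: add_divide_distrib diff_divide_distrib)
qed

text \<open>With y = arctan x the left side is sin (2 y) / 2, so this is sin (2 y) <= 2 y.\<close>

lemma div_one_plus_square_le_arctan:
  fixes x :: real
  assumes "x \<ge> 0"
  shows "x / (1 + x\<^sup>2) \<le> arctan x"
proof -
  have "2 * (x / (1 + x\<^sup>2)) = sin (2 * arctan x)"
    by (simp add: sin_double sin_arctan cos_arctan)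
  also have "\<dots> \<le> 2 * arctan x"
    using assms by (intro sin_x_le_x) simp
  finally show ?thesis
    by simp
qed

text \<open>Here \<open>d\<close> stands for the slope of an arc, \<open>A\<close> for the product
  of the two adjacent labels and \<open>q\<close> for the root of |D|. With x = q / d, the tangent
  of the angle, the two fluxes become 4 x / (1 + x^2) and 16 x^3 / (1 + x^2)^2. Apart from the sign
  statement the bounds are multiples of the angle, because the angles on a sphere have a known
  sum.\<close>

lemma flux_bounds:
  fixes q d A m :: real
  assumes q: "q > 0" and m: "m > 0" "d \<ge> m" and disc: "4 * A = d\<^sup>2 + q\<^sup>2"
  shows "q * (d / A) \<le> 4 * (pi / 2 - arctan (d / q))"
    and "4 / (1 + (q / m)\<^sup>2) * (pi / 2 - arctan (d / q)) \<le> q * (d / A)"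
    and "0 \<le> d / A\<^sup>2"
    and "q ^ 3 * (d / A\<^sup>2) \<le> 16 * (q / m)\<^sup>2 * (pi / 2 - arctan (d / q))"
proof -
  define x where "x = q / d"
  have s: "d > 0"
    using m by simp
  have x: "x > 0"
    using s q by (simp add: x_def)
  have \<theta>: "pi / 2 - arctan (d / q) = arctan x"
    using arctan_inverse[of "d / q"] s q
    by (simp add: x_def sgn_if divide_simps)
  have xm: "x\<^sup>2 \<le> (q / m)\<^sup>2"
    unfolding x_def using m q by (intro power_mono divide_left_mono) auto
  have slx: "d = q / x"
    using s q by (simp add: x_def)
  have prod: "A = q\<^sup>2 * (1 + x\<^sup>2) / (4 * x\<^sup>2)"
    using disc x unfolding slx by (simp add: field_simps)
  have nz: "1 + x\<^sup>2 \<noteq> 0"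
    by (metis add_pos_nonneg less_numeral_extra(1) less_irrefl zero_le_power2)
  have f: "q * (d / A) = 4 * (x / (1 + x\<^sup>2))"
    unfolding prod unfolding slx using x q nz
    by (simp add: divide_simps power2_eq_square)
  have f2: "q ^ 3 * (d / A\<^sup>2) = 16 * (x\<^sup>2 * ((x / (1 + x\<^sup>2)) * (1 / (1 + x\<^sup>2))))"
    unfolding prod unfolding slx using x q nz
    by (simp add: divide_simps power2_eq_square power3_eq_cube)
  have le: "x / (1 + x\<^sup>2) \<le> arctan x"
    using x by (intro div_one_plus_square_le_arctan) simp
  have at: "0 \<le> arctan x" "arctan x \<le> x"
    using x by (auto intro: arctan_le_self)
  show "q * (d / A) \<le> 4 * (pi / 2 - arctan (d / q))"
    using le f \<theta> by simp
  \<comment> \<open>The coefficient is taken at q / m, the largest possible \<open>x\<close>, and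
    \<open>arctan x\<close> is enlarged to \<open>x\<close>.\<close>
  have "4 / (1 + (q / m)\<^sup>2) * (pi / 2 - arctan (d / q)) \<le> 4 / (1 + x\<^sup>2) * x"
    unfolding \<theta> using at xm x
    by (intro mult_mono divide_left_mono) (auto intro!: mult_pos_pos add_pos_nonneg)
  then show "4 / (1 + (q / m)\<^sup>2) * (pi / 2 - arctan (d / q)) \<le> q * (d / A)"
    using f by simp
  show "0 \<le> d / A\<^sup>2"
    using s by simp
  have "(x / (1 + x\<^sup>2)) * (1 / (1 + x\<^sup>2)) \<le> arctan x * 1"
    using le at x by (intro mult_mono) (auto simp: divide_le_eq add_pos_nonneg)
  from mult_mono[OF xm this] x
  have "x\<^sup>2 * ((x / (1 + x\<^sup>2)) * (1 / (1 + x\<^sup>2))) \<le> (q / m)\<^sup>2 * (arctan x * 1)"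
    by simp
  then show "q ^ 3 * (d / A\<^sup>2) \<le> 16 * (q / m)\<^sup>2 * (pi / 2 - arctan (d / q))"
    unfolding f2 \<theta> by simp
qed

text \<open>Turns a limit along growing balls into an unordered sum. The increasing partial sums are
  bounded by their limit, which gives summability.\<close>

lemma has_sum_exhaustion:
  fixes f :: "'a \<Rightarrow> real"
  assumes fin: "\<And>n. finite (B n)" and inc: "incseq B" and UN: "(\<Union>n. B n) = A"
    and nonneg: "\<And>x. f x \<ge> 0" and lim: "(\<lambda>n. \<Sum>x\<in>B n. f x) \<longlonglongrightarrow> S"
  shows "(f has_sum S) A"
proof -
  have sub: "\<exists>n. F \<subseteq> B n" if "finite F" "F \<subseteq> A" for F
    using that
  proof (induction F rule: finite_induct)
    case (insert x F)
    then obtain m n where "F \<subseteq> B m" "x \<in> B n"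
      using UN by auto
    then have "insert x F \<subseteq> B (max m n)"
      using incseqD[OF inc, of m "max m n"] incseqD[OF inc, of n "max m n"] by auto
    then show ?case ..
  qed simp
  have "incseq (\<lambda>n. \<Sum>x\<in>B n. f x)"
    using incseqD[OF inc] fin nonneg by (intro incseq_SucI sum_mono2) auto
  then have le: "(\<Sum>x\<in>B n. f x) \<le> S" for n
    using lim by (rule incseq_le)
  have "sum f F \<le> S" if F: "finite F" "F \<subseteq> A" for F
  proof -
    obtain n where "F \<subseteq> B n"
      using sub[OF F] by blast
    then have "sum f F \<le> (\<Sum>x\<in>B n. f x)"
      by (rule sum_mono2[OF fin]) (rule nonneg)
    then show ?thesis
      using le[of n] by simp
  qed
  then have "f summable_on A"
    using nonneg by (intro nonneg_bdd_above_summable_on) (auto simp: bdd_above_def)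
  then have sum: "(f has_sum infsum f A) A"
    by (rule has_sum_infsum)
  \<comment> \<open>The exhaustion eventually contains every finite subset, so convergence along the
    net of finite subsets passes to the sequence \<open>B\<close>.\<close>
  have "filterlim B (finite_subsets_at_top A) sequentially"
    unfolding filterlim_finite_subsets_at_top
  proof safe
    fix F assume "finite F" "F \<subseteq> A"
    then obtain n where n: "F \<subseteq> B n"
      using sub by blast
    have "finite (B m) \<and> F \<subseteq> B m \<and> B m \<subseteq> A" if "m \<ge> n" for m
      using that n incseqD[OF inc, of n m] fin UN by auto
    then show "\<forall>\<^sub>F m in sequentially. finite (B m) \<and> F \<subseteq> B m \<and> B m \<subseteq> A"
      by (auto simp: eventually_sequentially)
  qed
  then have "(\<lambda>n. \<Sum>x\<in>B n. f x) \<longlonglongrightarrow> infsum f A"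
    using sum unfolding has_sum_def by (rule filterlim_compose[rotated])
  then have "infsum f A = S"
    using lim by (rule LIMSEQ_unique)
  then show ?thesis
    using sum by simp
qed

section \<open>Reduced walks in a plane cubic tree\<close>

context plane_cubic_tree
begin

text \<open>In a tree the walks without backtracking are exactly the paths, but this condition is
  local and easily checked when an arc is appended.\<close>

definition reduced :: "'e list \<Rightarrow> bool" where
  "reduced = successively (\<lambda>a b. b \<noteq> arev a)"

lemma reduced_Nil [simp]: "reduced []"
  by (simp add: reduced_def)

lemma reduced_append_iff:
  "reduced (p @ q) \<longleftrightarrow>
     reduced p \<and> reduced q \<and> (p = [] \<or> q = [] \<or> hd q \<noteq> arev (last p))"
  by (simp add: reduced_def successively_append_iff)

lemma reduced_Cons: "reduced (a # p) \<longleftrightarrow> p = [] \<or> hd p \<noteq> arev a \<and> reduced p"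
  by (simp add: reduced_def successively_Cons)

lemma awalk_reverse: "awalk u p v \<Longrightarrow> awalk v (map arev (rev p)) u"
proof (induction p arbitrary: u)
  case (Cons a p)
  then have "awalk v (map arev (rev p)) (head G a)" "awalk (head G a) [arev a] u"
    by (auto simp: awalk_simps)
  then show ?case
    by (auto dest: awalk_appendI)
qed (simp add: awalk_simps)

lemma reduced_reverse:
  assumes "reduced p"
  shows "reduced (map arev (rev p))"
proof -
  have "successively (\<lambda>a b. arev a \<noteq> b) p"
    using assms unfolding reduced_def by (rule successively_mono) auto
  then show ?thesis
    unfolding reduced_def successively_map successively_rev by (simp add: arev_eq_iff)
qed

text \<open>A nonempty such walk either is a cycle, hence of the form [a, arev a] and not reduced,
  or contains a shorter nonempty closed walk, again reduced.\<close>

lemma reduced_closed_walk_Nil: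
  assumes "awalk u p u" and "reduced p"
  shows "p = []"
  using assms
proof (induction "length p" arbitrary: u p rule: less_induct)
  case less
  show ?case
  proof (cases p)
    case (Cons e es)
    have es: "awalk (head G e) es u" "reduced es"
      using less.prems Cons by (auto simp: awalk_simps reduced_Cons)
    show ?thesis
    proof (cases "distinct (awalk_verts (head G e) es)")
      case True
      then have "cycle p"
        using less.prems Cons unfolding cycle_def by auto
      then obtain a where "p = [a, arev a]"
        using acyclic by blast
      then show ?thesis
        using less.prems by (simp add: reduced_Cons)
    next
      case False
      from awalk_not_distinct_decomp[OF es(1) False]
      obtain q r s w where "es = q @ r @ s" "0 < length r" "awalk w r w"
        by blast
      moreover from this have "reduced r"
        using es by (simp add: reduced_append_iff)
      ultimately show ?thesis
        using less.hyps[of r w] Cons by simp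
    qed
  qed simp
qed

text \<open>Equal last arcs are stripped off; if they differ, one walk followed by the reverse of
  the other is a nonempty reduced closed walk.\<close>

lemma reduced_walk_unique:
  assumes "awalk u p v" "awalk u q v" "reduced p" "reduced q"
  shows "p = q"
  using assms
proof (induction p arbitrary: q v rule: rev_induct)
  case Nil
  then show ?case
    using reduced_closed_walk_Nil by (metis awalk_Nil_iff)
next
  case (snoc a p)
  show ?case
  proof (cases q rule: rev_cases)
    case Nil
    then show ?thesis
      using snoc.prems reduced_closed_walk_Nil by (metis awalk_Nil_iff)
  next
    case (snoc q' b)
    show ?thesis
    proof (cases "a = b")
      case True
      have "awalk u p (tail G a)" "awalk u q' (tail G a)"
        using snoc.prems snoc True by (auto simp: awalk_simps)
      then show ?thesis
        using snoc.IH snoc.prems snoc True by (auto simp: reduced_append_iff)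
    next
      case False
      have "awalk u ((p @ [a]) @ map arev (rev q)) u"
        using snoc.prems(1) awalk_reverse[OF snoc.prems(2)] by (rule awalk_appendI)
      moreover have "reduced ((p @ [a]) @ map arev (rev q))"
        using snoc.prems(3) reduced_reverse[OF snoc.prems(4)] snoc False
        by (subst reduced_append_iff) (auto simp: arev_eq_iff)
      ultimately show ?thesis
        using reduced_closed_walk_Nil by blast
    qed
  qed
qed

text \<open>A backtracking step would return to a vertex already visited. With connectedness, every
  vertex is thus the end of a reduced walk.\<close>

lemma apath_reduced: "apath u p v \<Longrightarrow> reduced p"
proof (induction p arbitrary: u)
  case (Cons e es)
  then have es: "apath (head G e) es v" "u \<notin> set (awalk_verts (head G e) es)"
      "tail G e = u" "e \<in> arcs G"
    by (auto simp: apath_Cons_iff)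
  have "hd es \<noteq> arev e" if ne: "es \<noteq> []"
  proof
    assume "hd es = arev e"
    then obtain fs where "es = arev e # fs"
      using ne by (cases es) auto
    moreover from this es have "awalk u fs v"
      by (auto dest: awalkI_apath simp: awalk_Cons_iff)
    ultimately show False
      using es hd_in_awalk_verts(1) by auto
  qed
  then show ?case
    using Cons.IH[OF es(1)] by (auto simp: reduced_Cons)
qed simp

section \<open>Spheres and balls around a vertex\<close>

definition sphere :: "'v \<Rightarrow> nat \<Rightarrow> 'e list set" where
  "sphere u n = {p. (\<exists>v. awalk u p v) \<and> reduced p \<and> length p = n}"

lemma sphereI: "awalk u p v \<Longrightarrow> reduced p \<Longrightarrow> length p = n \<Longrightarrow> p \<in> sphere u n"
  by (auto simp: sphere_def)

definition extensions :: "'v \<Rightarrow> 'e list \<Rightarrow> 'e set" where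
  "extensions u p =
     (if p = [] then out_arcs G u else out_arcs G (head G (last p)) - {arev (last p)})"

text \<open>Spheres consist of walks because the telescoping sums refer to last arcs; the end points
  give the vertices, bijectively by uniqueness of reduced walks.\<close>

definition ball_verts :: "'v \<Rightarrow> nat \<Rightarrow> 'v set" where
  "ball_verts u n = awlast u ` (\<Union>k\<le>n. sphere u k)"

lemma finite_out_arcs: "v \<in> verts G \<Longrightarrow> finite (out_arcs G v)"
  using cubic[of v] by (metis card.infinite out_degree_def zero_neq_numeral)

lemma awlast_eq: "awlast u p = (if p = [] then u else head G (last p))"
  by (simp add: awalk_verts_conv)

lemma sphere_0: "u \<in> verts G \<Longrightarrow> sphere u 0 = {[]}"
  by (auto simp: sphere_def awalk_simps)

lemma sphere_Suc: "sphere u (Suc n) = (\<lambda>(p, b). p @ [b]) ` (SIGMA p:sphere u n. extensions u p)"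
  (is "?L = ?R")
proof
  show "?L \<subseteq> ?R"
  proof
    fix q assume q: "q \<in> ?L"
    then obtain p b where pb: "q = p @ [b]"
      by (cases q rule: rev_cases) (auto simp: sphere_def)
    then have "awalk u p (tail G b)" "b \<in> arcs G" "reduced (p @ [b])" "length p = n"
      using q by (auto simp: sphere_def awalk_simps)
    then have "p \<in> sphere u n" "b \<in> extensions u p"
      by (auto simp: sphere_def extensions_def reduced_append_iff awlast_eq dest: awlast_of_awalk)
    then show "q \<in> ?R"
      using pb by force
  qed
  show "?R \<subseteq> ?L"
  proof safe
    fix p b assume pb: "p \<in> sphere u n" "b \<in> extensions u p"
    then obtain v where v: "awalk u p v" "reduced p" "length p = n"
      by (auto simp: sphere_def)
    then have "v = awlast u p"
      by simp
    with pb v have "awalk u p (tail G b)" "b \<in> arcs G" "reduced (p @ [b])"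
      by (auto simp: extensions_def reduced_append_iff reduced_Cons awlast_eq split: if_splits)
    with v show "p @ [b] \<in> ?L"
      by (intro sphereI[of _ _ "head G b"]) (auto simp: awalk_simps)
  qed
qed

lemma sphere_awlast: "p \<in> sphere u n \<Longrightarrow> awlast u p \<in> verts G"
  by (auto simp: sphere_def intro: awalk_last_in_verts)

lemma sphere_last: "p \<in> sphere u (Suc n) \<Longrightarrow> last p \<in> arcs G"
  by (cases p rule: rev_cases) (auto simp: sphere_def awalk_simps)

lemma extensions_subset: "extensions u p \<subseteq> out_arcs G (awlast u p)"
  by (auto simp: extensions_def awlast_eq)

lemma finite_extensions: "p \<in> sphere u n \<Longrightarrow> finite (extensions u p)"
  using finite_out_arcs[OF sphere_awlast] extensions_subset finite_subset by metis

lemma finite_sphere: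
  assumes "u \<in> verts G"
  shows "finite (sphere u n)"
  using assms by (induction n) (auto simp: sphere_0 sphere_Suc finite_extensions)

lemma sum_sphere_Suc:
  assumes "u \<in> verts G"
  shows "(\<Sum>p\<in>sphere u (Suc n). g (last p)) = (\<Sum>p\<in>sphere u n. \<Sum>b\<in>extensions u p. g b)"
proof -
  have "inj_on (\<lambda>(p, b). p @ [b]) (SIGMA p:sphere u n. extensions u p)"
    by (auto simp: inj_on_def)
  then have "(\<Sum>p\<in>sphere u (Suc n). g (last p)) =
      (\<Sum>(p, b)\<in>(SIGMA p:sphere u n. extensions u p). g b)"
    unfolding sphere_Suc by (subst sum.reindex) (auto intro!: sum.cong)
  also have "\<dots> = (\<Sum>p\<in>sphere u n. \<Sum>b\<in>extensions u p. g b)"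
    using assms finite_extensions by (subst sum.Sigma) (auto simp: finite_sphere)
  finally show ?thesis .
qed

text \<open>Every inner edge is traversed in both directions and contributes \<open>c\<close>; only the arcs that
  leave the ball survive.\<close>

lemma telescope_sphere:
  fixes g :: "'e \<Rightarrow> real"
  assumes u: "u \<in> verts G"
    and arev: "\<And>a. a \<in> arcs G \<Longrightarrow> g (arev a) = c - g a"
    and vertex: "\<And>v. v \<in> verts G \<Longrightarrow> (\<Sum>a\<in>out_arcs G v. g a) = c + F v"
  shows "(\<Sum>p\<in>sphere u (Suc n). g (last p)) = c + (\<Sum>k\<le>n. \<Sum>p\<in>sphere u k. F (awlast u p))"
proof (induction n)
  case 0
  then show ?case
    using u by (simp add: sum_sphere_Suc sphere_0 extensions_def vertex)
next
  case (Suc n)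
  \<comment> \<open>Of the vertex total c + F only the value c - g of the arc pointing back is
    missing, which leaves g + F.\<close>
  have "(\<Sum>b\<in>extensions u p. g b) = g (last p) + F (awlast u p)" if "p \<in> sphere u (Suc n)" for p
  proof -
    have p: "last p \<in> arcs G" "p \<noteq> []"
      using that sphere_last by (auto simp: sphere_def)
    then have "head G (last p) \<in> verts G" "arev (last p) \<in> out_arcs G (head G (last p))"
      by auto
    then show ?thesis
      using p by (simp add: extensions_def sum_diff1 finite_out_arcs vertex arev awlast_eq)
  qed
  then have "(\<Sum>p\<in>sphere u (Suc (Suc n)). g (last p)) =
      (\<Sum>p\<in>sphere u (Suc n). g (last p) + F (awlast u p))"
    using u by (simp add: sum_sphere_Suc[of _ _ "Suc n"])
  then show ?case
    using Suc.IH by (simp add: sum.distrib)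
qed

lemma inj_on_awlast: "inj_on (awlast u) (\<Union>n. sphere u n)"
proof (rule inj_onI)
  fix p q assume "p \<in> (\<Union>n. sphere u n)" "q \<in> (\<Union>n. sphere u n)" "awlast u p = awlast u q"
  then show "p = q"
    by (auto simp: sphere_def intro: reduced_walk_unique)
qed

lemma sum_ball_verts:
  assumes "u \<in> verts G"
  shows "(\<Sum>v\<in>ball_verts u n. F v) = (\<Sum>k\<le>n. \<Sum>p\<in>sphere u k. F (awlast u p))"
proof -
  have "inj_on (awlast u) (\<Union>k\<le>n. sphere u k)"
    using inj_on_awlast by (rule inj_on_subset) auto
  then have "(\<Sum>v\<in>ball_verts u n. F v) = (\<Sum>p\<in>(\<Union>k\<le>n. sphere u k). F (awlast u p))"
    by (simp add: ball_verts_def sum.reindex)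
  also have "\<dots> = (\<Sum>k\<le>n. \<Sum>p\<in>sphere u k. F (awlast u p))"
    using assms by (intro sum.UNION_disjoint) (auto simp: finite_sphere, auto simp: sphere_def)
  finally show ?thesis .
qed

lemma finite_ball_verts: "u \<in> verts G \<Longrightarrow> finite (ball_verts u n)"
  by (simp add: ball_verts_def finite_sphere)

lemma incseq_ball_verts: "incseq (ball_verts u)"
  unfolding incseq_def ball_verts_def by (intro allI impI image_mono UN_mono) auto

lemma UN_ball_verts:
  assumes "u \<in> verts G"
  shows "(\<Union>n. ball_verts u n) = verts G"
proof
  show "(\<Union>n. ball_verts u n) \<subseteq> verts G"
    using sphere_awlast by (auto simp: ball_verts_def)
  show "verts G \<subseteq> (\<Union>n. ball_verts u n)"
  proof
    fix v assume "v \<in> verts G"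
    then have "u \<rightarrow>\<^sup>*\<^bsub>G\<^esub> v"
      using assms symmetric_connected_imp_strongly_connected[OF sym_arcs connected] by auto
    then obtain p where p: "apath u p v"
      by (auto simp: reachable_apath)
    then have "p \<in> sphere u (length p)" "awlast u p = v"
      using sphereI[OF awalkI_apath[OF p] apath_reduced[OF p]] awalkI_apath[OF p] by auto
    then show "v \<in> (\<Union>n. ball_verts u n)"
      by (force simp: ball_verts_def)
  qed
qed

section \<open>The three arcs leaving a vertex\<close>

text \<open>A cyclic permutation of three elements: a return after fewer than three steps would make
  the orbit too small.\<close>

lemma rot_corner:
  assumes "a \<in> arcs G"
  shows "out_arcs G (tail G a) = {a, rot a, rot (rot a)}"
    and "distinct [a, rot a, rot (rot a)]"
    and "rot (rot (rot a)) = a"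
proof -
  let ?S = "out_arcs G (tail G a)"
  have v: "tail G a \<in> verts G" and a: "a \<in> ?S"
    using assms by auto
  have inj: "rot x = rot y \<longleftrightarrow> x = y" for x y
    using permutes_inj[OF rot_permutes] by (auto dest: injD)
  have orb: "?S = orbit rot a"
    using rot_cyclic[OF v] a by (auto simp: cyclic_on_alldef)
  have card: "card ?S = 3" and fin: "finite ?S"
    using cubic[OF v] finite_out_arcs[OF v] by (auto simp: out_degree_def)
  have S: "rot x \<in> ?S" if "x \<in> ?S" for x
    using rot_cyclic[OF v] that by (rule cyclic_on_inI)
  \<comment> \<open>The inductive \<open>orbit\<close> starts at \<open>rot a\<close>, not at
    \<open>a\<close>, hence the form of the first premise.\<close>
  have closed: "?S \<subseteq> X" if "rot a \<in> X" "\<And>x. x \<in> X \<Longrightarrow> rot x \<in> X" for X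
  proof
    fix x assume "x \<in> ?S"
    then show "x \<in> X"
      unfolding orb by induction (auto intro: that)
  qed
  have small: False if "rot (rot a) = a"
  proof -
    have "?S \<subseteq> {a, rot a}"
      using that by (intro closed) auto
    then have "card ?S \<le> card {a, rot a}"
      by (intro card_mono) auto
    also have "\<dots> \<le> 2"
      by (simp add: card_insert_if)
    finally show False
      using card by simp
  qed
  then have "rot a \<noteq> a"
    by metis
  with small show dist: "distinct [a, rot a, rot (rot a)]"
    by (auto simp: inj)
  then have "card {a, rot a, rot (rot a)} = card ?S"
    using card by simp
  then show eq: "?S = {a, rot a, rot (rot a)}"
    using S a fin by (intro card_subset_eq[symmetric]) auto
  have "rot (rot (rot a)) \<in> {a, rot a, rot (rot a)}"
    using S[OF S[OF S[OF a]]] eq by simp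
  then show "rot (rot (rot a)) = a"
    using dist by (auto simp: inj)
qed

lemma rot_in_arcs: "a \<in> arcs G \<Longrightarrow> rot a \<in> arcs G"
  using permutes_in_image[OF rot_permutes] by simp

lemma sum_out_arcs:
  fixes f :: "'e \<Rightarrow> 'b::comm_monoid_add"
  assumes "a \<in> arcs G"
  shows "(\<Sum>b\<in>out_arcs G (tail G a). f b) = f a + (f (rot a) + f (rot (rot a)))"
  using rot_corner[OF assms] by simp

lemma prod_out_arcs:
  fixes f :: "'e \<Rightarrow> 'b::comm_monoid_mult"
  assumes "a \<in> arcs G"
  shows "(\<Prod>b\<in>out_arcs G (tail G a). f b) = f a * (f (rot a) * f (rot (rot a)))"
  using rot_corner[OF assms] by simp

lemma vertex_arcE:
  assumes "v \<in> verts G"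
  obtains a where "a \<in> arcs G" "tail G a = v"
proof -
  have "out_arcs G v \<noteq> {}"
    using cubic[OF assms] by (auto simp: out_degree_def)
  then obtain a where "a \<in> out_arcs G v"
    by blast
  then have "a \<in> arcs G" "tail G a = v"
    by auto
  then show ?thesis
    by (rule that)
qed

section \<open>Regions around a vertex\<close>

lemma left_region_next:
  "left_region arev rot (next_on_boundary arev rot a) = left_region arev rot a"
proof -
  let ?f = "next_on_boundary arev rot"
  have "inj (inv rot)"
    using permutes_bij[OF rot_permutes] by (simp add: bij_imp_bij_inv bij_is_inj)
  then have "inj ?f"
    unfolding next_on_boundary_def using bij_arev by (intro inj_compose) (auto simp: bij_is_inj)
  then have inj: "?f x = ?f y \<longleftrightarrow> x = y" for x y
    by (auto dest: injD)
  show ?thesis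
    unfolding left_region_def
  proof (intro Collect_cong iffI)
    fix b
    assume "\<exists>n. (?f ^^ n) (?f a) = b \<or> (?f ^^ n) b = ?f a"
    then obtain n where "(?f ^^ n) (?f a) = b \<or> (?f ^^ n) b = ?f a" ..
    then show "\<exists>n. (?f ^^ n) a = b \<or> (?f ^^ n) b = a"
    proof
      assume "(?f ^^ n) (?f a) = b"
      then have "(?f ^^ Suc n) a = b"
        by (simp add: funpow_swap1)
      then show ?thesis by blast
    next
      assume *: "(?f ^^ n) b = ?f a"
      show ?thesis
      proof (cases n)
        \<comment> \<open>Now \<open>b\<close> is \<open>?f a\<close> itself, reached forwards from
          \<open>a\<close>; for positive \<open>n\<close> injectivity cancels one step
          instead.\<close>
        case 0
        then have "(?f ^^ 1) a = b"
          using * by simp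
        then show ?thesis by blast
      next
        case (Suc m)
        then have "(?f ^^ m) b = a"
          using * by (simp add: inj)
        then show ?thesis by blast
      qed
    qed
  next
    fix b
    assume "\<exists>n. (?f ^^ n) a = b \<or> (?f ^^ n) b = a"
    then obtain n where "(?f ^^ n) a = b \<or> (?f ^^ n) b = a" ..
    then show "\<exists>n. (?f ^^ n) (?f a) = b \<or> (?f ^^ n) b = ?f a"
    proof
      assume *: "(?f ^^ n) a = b"
      show ?thesis
      proof (cases n)
        case 0
        then have "(?f ^^ 1) b = ?f a"
          using * by simp
        then show ?thesis by blast
      next
        case (Suc m)
        then have "(?f ^^ m) (?f a) = b"
          using * by (simp add: funpow_swap1)
        then show ?thesis by blast
      qed
    next
      assume "(?f ^^ n) b = a"
      then have "(?f ^^ Suc n) b = ?f a"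
        by simp
      then show ?thesis by blast
    qed
  qed
qed

text \<open>The boundary walk continues from \<open>arev a\<close> with the clockwise neighbour of
  \<open>a\<close>, which is \<open>rot (rot a)\<close> as only three arcs leave the tail. So the
  right region of an arc is a corner at its tail.\<close>

lemma left_region_arev:
  assumes "a \<in> arcs G"
  shows "left_region arev rot (arev a) = left_region arev rot (rot (rot a))"
proof -
  have "next_on_boundary arev rot (arev a) = inv rot a"
    by (simp add: next_on_boundary_def)
  also have "\<dots> = rot (rot a)"
    using rot_corner(3)[OF assms] permutes_inv_eq[OF rot_permutes] by metis
  finally show ?thesis
    using left_region_next[of "arev a"] by simp
qed

end


section \<open>Topographs of negative discriminant\<close>

locale definite_topograph = topograph +
  fixes D :: int
  assumes discriminant: "has_discriminant G arev rot lab D"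
    and negative: "D < 0"
begin

abbreviation l :: "'b \<Rightarrow> int" where
  "l a \<equiv> lab (left_region arev rot a)"

text \<open>Labels near an arc share one sign, so their absolute values again obey the edge law;
  positive and negative topographs are thereby treated at once.\<close>

definition size_left :: "'b \<Rightarrow> real" where
  "size_left a = real_of_int \<bar>l a\<bar>"

text \<open>On arcs this is the edge label times the common sign of the adjacent labels.\<close>

definition slope :: "'b \<Rightarrow> real" where
  "slope a = size_left a + size_left (arev a) - size_left (rot a)"

text \<open>In a configuration [a, b, c] one has 4 a c = b^2 - D > 0.\<close>

lemma l_arev_pos:
  assumes "a \<in> arcs G"
  shows "l a * l (arev a) > 0"
proof -
  have "(edge_label arev rot lab a)\<^sup>2 - 4 * l a * l (arev a) = D"
    using discriminant assms
    by (auto simp: has_discriminant_def configuration_def right_region_def)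
  moreover have "(edge_label arev rot lab a)\<^sup>2 \<ge> 0"
    by simp
  ultimately show ?thesis
    using negative unfolding mult.assoc by linarith
qed

lemma l_arev_eq: "a \<in> arcs G \<Longrightarrow> l (arev a) = l (rot (rot a))"
  by (simp add: left_region_arev)

text \<open>The right region of \<open>rot a\<close> is the left region of \<open>a\<close>, so
  \<open>l_arev_pos\<close> applies to \<open>rot a\<close>.\<close>

lemma l_rot_pos:
  assumes "a \<in> arcs G"
  shows "l a * l (rot a) > 0"
  using l_arev_pos[OF rot_in_arcs[OF assms]] l_arev_eq[OF rot_in_arcs[OF assms]] rot_corner(3)[OF assms]
  by (simp add: mult.commute)

lemma sgn_l:
  assumes "a \<in> arcs G"
  shows "sgn (l (rot a)) = sgn (l a)" "sgn (l (arev a)) = sgn (l a)" "sgn (l (rot (rot a))) = sgn (l a)"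
    "l a \<noteq> 0"
  using l_arev_pos[OF assms] l_rot_pos[OF assms] l_arev_eq[OF assms]
  by (auto simp: zero_less_mult_iff)

lemma size_left_eq: "size_left a = sgn (l a) * l a"
  by (simp add: size_left_def abs_sgn mult.commute)

lemma size_left_ge_1: "a \<in> arcs G \<Longrightarrow> size_left a \<ge> 1"
  using sgn_l(4)[of a] unfolding size_left_def by linarith

lemma size_left_arev: "a \<in> arcs G \<Longrightarrow> size_left (arev a) = size_left (rot (rot a))"
  by (simp add: size_left_def left_region_arev)

lemma size_left_edge:
  assumes "a \<in> arcs G"
  shows "size_left (rot a) + size_left (rot (arev a)) = 2 * (size_left a + size_left (arev a))"
proof -
  have "l (rot a) + l (rot (arev a)) = 2 * (l a + l (arev a))"
    using edge_law[OF assms] by (simp add: tail_region_def head_region_def right_region_def)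
  then have "real_of_int (l (rot a)) + l (rot (arev a)) = 2 * (real_of_int (l a) + l (arev a))"
    by (metis of_int_add of_int_mult of_int_numeral)
  then have "sgn (l a) * (real_of_int (l (rot a)) + l (rot (arev a))) =
      sgn (l a) * (2 * (real_of_int (l a) + l (arev a)))"
    by simp
  then show ?thesis
    using sgn_l[OF assms] sgn_l[OF arev_in_arcs[OF assms]]
    by (simp add: size_left_eq algebra_simps)
qed

lemma slope_arev:
  assumes "a \<in> arcs G"
  shows "slope (arev a) = - slope a"
  using size_left_edge[OF assms] by (simp add: slope_def)

lemma slope_disc:
  assumes "a \<in> arcs G"
  shows "4 * size_left a * size_left (arev a) = (slope a)\<^sup>2 + \<bar>D\<bar>"
proof -
  have "(l a + l (arev a) - l (rot a))\<^sup>2 - 4 * l a * l (arev a) = D"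
    using discriminant assms
    by (auto simp: has_discriminant_def configuration_def right_region_def tail_region_def
        edge_label_def)
  then have D: "(real_of_int (l a) + l (arev a) - l (rot a))\<^sup>2 - 4 * l a * l (arev a) = D"
    by (metis of_int_add of_int_mult of_int_numeral of_int_diff of_int_power)
  have "sgn (l a) * sgn (l a) = 1"
    using sgn_l(4)[OF assms] by (simp add: sgn_if)
  then have s: "real_of_int (sgn (l a)) * real_of_int (sgn (l a)) = 1"
    by (metis of_int_1 of_int_mult)
  have "slope a = sgn (l a) * (real_of_int (l a) + l (arev a) - l (rot a))"
    using sgn_l[OF assms] by (simp add: slope_def size_left_eq algebra_simps)
  then have "(slope a)\<^sup>2 = (real_of_int (sgn (l a)) * sgn (l a)) * (real_of_int (l a) + l (arev a) - l (rot a))\<^sup>2"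
    by (simp add: power2_eq_square)
  moreover have "size_left a * size_left (arev a) =
      (real_of_int (sgn (l a)) * sgn (l a)) * (real_of_int (l a) * l (arev a))"
    using sgn_l[OF assms] by (simp add: size_left_eq)
  ultimately show ?thesis
    using D negative unfolding s by simp
qed

text \<open>At the head of \<open>a\<close> the two arcs other than \<open>arev a\<close> have slope increased by twice the label
  of a region adjacent to \<open>a\<close>.\<close>

lemma slope_climb:
  assumes a: "a \<in> arcs G" and b: "b \<in> out_arcs G (head G a)" "b \<noteq> arev a"
  shows "slope b \<ge> slope a + 2"
proof -
  let ?r = "arev a"
  have r: "?r \<in> arcs G"
    using a by simp
  have "b = rot ?r \<or> b = rot (rot ?r)"
    using rot_corner(1)[OF r] a b by auto
  moreover have "slope (rot ?r) = slope a + 2 * size_left ?r"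
    using size_left_edge[OF a] size_left_arev[OF r] size_left_arev[OF rot_in_arcs[OF r]]
      rot_corner(3)[OF r]
    by (simp add: slope_def)
  moreover have "slope (rot (rot ?r)) = slope a + 2 * size_left a"
    using size_left_edge[OF a] size_left_arev[OF r]
      size_left_arev[OF rot_in_arcs[OF rot_in_arcs[OF r]]] rot_corner(3)[OF r]
    by (simp add: slope_def)
  ultimately show ?thesis
    using size_left_ge_1[OF a] size_left_ge_1[OF r] by auto
qed

section \<open>Vertex sums, a valley vertex and the growth of slopes\<close>

lemma abs_vertex_sum:
  assumes "a \<in> arcs G"
  shows "\<bar>vertex_sum G arev rot lab (tail G a)\<bar> = size_left a + size_left (rot a) + size_left (rot (rot a))"
proof -
  have "\<bar>vertex_sum G arev rot lab (tail G a)\<bar> = \<bar>l a\<bar> + \<bar>l (rot a)\<bar> + \<bar>l (rot (rot a))\<bar>"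
    using sgn_l[OF assms] unfolding vertex_sum_def sum_out_arcs[OF assms]
    by (auto simp: sgn_if split: if_splits)
  then show ?thesis
    by (simp add: size_left_def)
qed

lemma abs_vertex_prod:
  assumes "a \<in> arcs G"
  shows "\<bar>vertex_prod G arev rot lab (tail G a)\<bar> = size_left a * size_left (rot a) * size_left (rot (rot a))"
  unfolding vertex_prod_def prod_out_arcs[OF assms] by (simp add: size_left_def abs_mult)

text \<open>The two ends share two regions, and by the edge law the third labels, in absolute value,
  differ by \<open>2 * slope a\<close>, head minus tail.\<close>

lemma slope_tail_min:
  assumes a: "a \<in> arcs G"
    and le: "\<bar>vertex_sum G arev rot lab (tail G a)\<bar> \<le> \<bar>vertex_sum G arev rot lab (head G a)\<bar>"
  shows "slope a \<ge> 0"
proof -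
  have r: "arev a \<in> arcs G"
    using a by simp
  have "real_of_int \<bar>vertex_sum G arev rot lab (tail G a)\<bar> \<le> real_of_int \<bar>vertex_sum G arev rot lab (head G a)\<bar>"
    using le by (rule of_int_le_iff[THEN iffD2])
  then show ?thesis
    using abs_vertex_sum[OF a] abs_vertex_sum[OF r] size_left_edge[OF a] a size_left_arev[OF a]
      size_left_arev[OF r]
    by (simp add: slope_def)
qed

text \<open>A vertex minimising |r + s + t| works; the minimum exists because these are natural
  numbers.\<close>

lemma valley_vertex: "\<exists>u\<in>verts G. \<forall>a\<in>out_arcs G u. slope a \<ge> 0"
proof -
  have "verts G \<noteq> {}"
    using connected unfolding connected_def strongly_connected_def by simp
  then obtain u where u: "u \<in> verts G"
    "\<And>v. v \<in> verts G \<Longrightarrow> nat \<bar>vertex_sum G arev rot lab u\<bar> \<le> nat \<bar>vertex_sum G arev rot lab v\<bar>"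
    using ex_has_least_nat[of "\<lambda>v. v \<in> verts G" _ "\<lambda>v. nat \<bar>vertex_sum G arev rot lab v\<bar>"] by blast
  have "slope a \<ge> 0" if "a \<in> out_arcs G u" for a
    using that u(2)[of "head G a"] by (intro slope_tail_min) auto
  with u(1) show ?thesis
    by blast
qed

text \<open>The first arc has slope at least 0 and each of the \<open>n\<close> further arcs adds at
  least 2 by \<open>slope_climb\<close>. The bound is uniform on the sphere.\<close>

lemma slope_sphere:
  assumes "u \<in> verts G" "\<And>a. a \<in> out_arcs G u \<Longrightarrow> slope a \<ge> 0"
  shows "p \<in> sphere u (Suc n) \<Longrightarrow> slope (last p) \<ge> 2 * real n"
proof (induction n arbitrary: p)
  case 0
  then show ?case
    using assms by (auto simp: sphere_Suc sphere_0 extensions_def)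
next
  case (Suc n)
  then obtain q b where qb: "p = q @ [b]" "q \<in> sphere u (Suc n)" "b \<in> extensions u q"
    by (subst (asm) sphere_Suc) auto
  then have "q \<noteq> []"
    by (auto simp: sphere_def)
  then have "slope b \<ge> slope (last q) + 2"
    using qb sphere_last by (intro slope_climb) (auto simp: extensions_def)
  then show ?case
    using Suc.IH[OF qb(2)] qb(1) by simp
qed

section \<open>Angles and fluxes of arcs\<close>

definition root_disc :: real where
  "root_disc = sqrt \<bar>D\<bar>"

text \<open>The angle opposite to \<open>sqrt (size_left (rot a))\<close> in the triangle whose sides are the square roots of
  the labels at the tail of \<open>a\<close>.\<close>

definition angle :: "'b \<Rightarrow> real" where
  "angle a = pi / 2 - arctan (slope a / root_disc)"

definition inv_prod :: "'a \<Rightarrow> real" where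
  "inv_prod v = 1 / real_of_int \<bar>vertex_prod G arev rot lab v\<bar>"

definition sum_inv_prod_sq :: "'a \<Rightarrow> real" where
  "sum_inv_prod_sq v =
     real_of_int \<bar>vertex_sum G arev rot lab v\<bar> / real_of_int \<bar>vertex_prod G arev rot lab v\<bar> ^ 2"

definition flux :: "'b \<Rightarrow> real" where
  "flux a = slope a / (size_left a * size_left (arev a))"

definition flux_sq :: "'b \<Rightarrow> real" where
  "flux_sq a = slope a / (size_left a * size_left (arev a))\<^sup>2"

lemma root_disc_pos: "root_disc > 0"
  using negative by (simp add: root_disc_def)

lemma abs_D: "\<bar>real_of_int D\<bar> = root_disc\<^sup>2"
  by (simp add: root_disc_def)

lemma angle_arev: "a \<in> arcs G \<Longrightarrow> angle (arev a) = pi - angle a"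
  by (simp add: angle_def slope_arev arctan_minus)

lemma flux_arev: "a \<in> arcs G \<Longrightarrow> flux (arev a) = - flux a"
  by (simp add: flux_def slope_arev mult.commute)

lemma flux_sq_arev: "a \<in> arcs G \<Longrightarrow> flux_sq (arev a) = - flux_sq a"
  by (simp add: flux_sq_def slope_arev mult.commute)

text \<open>Expresses everything at a vertex in r, s, t so that the polynomial identities apply; the
  formula for |D| is 4 r t = (r + t - s)^2 + |D| expanded.\<close>

lemma slopes_at_vertex:
  assumes a: "a \<in> arcs G"
  defines "(r::real) \<equiv> size_left a" and "(s::real) \<equiv> size_left (rot a)" and "(t::real) \<equiv> size_left (rot (rot a))"
  shows "slope a = r + t - s" "slope (rot a) = s + r - t" "slope (rot (rot a)) = t + s - r"
    and "size_left (arev a) = t" "size_left (arev (rot a)) = r" "size_left (arev (rot (rot a))) = s"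
    and "r > 0" "s > 0" "t > 0"
    and "real_of_int \<bar>D\<bar> = 2 * r * s + 2 * r * t + 2 * s * t - r\<^sup>2 - s\<^sup>2 - t\<^sup>2"
proof -
  note b = rot_in_arcs[OF a] and c = rot_in_arcs[OF rot_in_arcs[OF a]]
  show arevs: "size_left (arev a) = t" "size_left (arev (rot a)) = r" "size_left (arev (rot (rot a))) = s"
    using rot_corner(3)[OF a] by (simp_all add: r_def s_def t_def size_left_arev a b c)
  then show sl: "slope a = r + t - s" "slope (rot a) = s + r - t" "slope (rot (rot a)) = t + s - r"
    using rot_corner(3)[OF a] by (simp_all add: slope_def r_def s_def t_def)
  show "r > 0" "s > 0" "t > 0"
    using size_left_ge_1[OF a] size_left_ge_1[OF b] size_left_ge_1[OF c]
    by (simp_all add: r_def s_def t_def)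
  show "real_of_int \<bar>D\<bar> = 2 * r * s + 2 * r * t + 2 * s * t - r\<^sup>2 - s\<^sup>2 - t\<^sup>2"
    using slope_disc[OF a] arevs sl unfolding r_def[symmetric]
    by (simp add: power2_eq_square algebra_simps)
qed

lemma flux_vertex:
  assumes "v \<in> verts G"
  shows "(\<Sum>a\<in>out_arcs G v. flux a) = \<bar>D\<bar> * inv_prod v"
proof -
  obtain a where a: "a \<in> arcs G" "tail G a = v"
    using vertex_arcE[OF assms] .
  note sv = slopes_at_vertex[OF a(1)]
  have "(\<Sum>a\<in>out_arcs G v. flux a) = \<bar>D\<bar> * (1 / (size_left a * size_left (rot a) * size_left (rot (rot a))))"
    using flux_identity[OF sv(7-9)] sum_out_arcs[OF a(1), of flux]
    by (simp only: a(2) flux_def sv(1-6) sv(10))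
  then show ?thesis
    using abs_vertex_prod[OF a(1)] by (simp only: a(2) inv_prod_def)
qed

lemma flux_sq_vertex:
  assumes "v \<in> verts G"
  shows "(\<Sum>a\<in>out_arcs G v. flux_sq a) = \<bar>D\<bar> * sum_inv_prod_sq v - 6 * inv_prod v"
proof -
  obtain a where a: "a \<in> arcs G" "tail G a = v"
    using vertex_arcE[OF assms] .
  note sv = slopes_at_vertex[OF a(1)]
  have "(\<Sum>a\<in>out_arcs G v. flux_sq a) =
      \<bar>D\<bar> * ((size_left a + size_left (rot a) + size_left (rot (rot a))) /
        (size_left a * size_left (rot a) * size_left (rot (rot a)))\<^sup>2)
      - 6 * (1 / (size_left a * size_left (rot a) * size_left (rot (rot a))))"
    using flux_sq_identity[OF sv(7-9)] sum_out_arcs[OF a(1), of flux_sq]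
    by (simp only: a(2) flux_sq_def sv(1-6) sv(10))
  then show ?thesis
    using abs_vertex_prod[OF a(1)] abs_vertex_sum[OF a(1)]
    by (simp only: a(2) inv_prod_def sum_inv_prod_sq_def)
qed

text \<open>The slopes divided by \<open>root_disc\<close> are the cotangents of the angles, and the
  pairwise products of the slopes add up to |D|.\<close>

lemma angle_vertex:
  assumes "v \<in> verts G"
  shows "(\<Sum>a\<in>out_arcs G v. angle a) = pi"
proof -
  obtain a where a: "a \<in> arcs G" "tail G a = v"
    using vertex_arcE[OF assms] .
  note sv = slopes_at_vertex[OF a(1)]
  define x y z where "x = slope a / root_disc" and "y = slope (rot a) / root_disc"
    and "z = slope (rot (rot a)) / root_disc"
  \<comment> \<open>The sum is \<open>2 * size_left a\<close>.\<close>
  have "slope a + slope (rot a) > 0"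
    using sv by simp
  then have pos: "x + y > 0"
    using root_disc_pos unfolding x_def y_def by (simp flip: add_divide_distrib)
  have "slope a * slope (rot a) + slope a * slope (rot (rot a)) + slope (rot a) * slope (rot (rot a)) = root_disc\<^sup>2"
    unfolding abs_D[symmetric] of_int_abs[symmetric] sv(1-6) sv(10) by (simp add: power2_eq_square algebra_simps)
  then have "x * y + x * z + y * z = 1"
    using root_disc_pos unfolding x_def y_def z_def
    by (simp add: divide_simps power2_eq_square)
  then have "arctan x + arctan y + arctan z = pi / 2"
    using pos by (intro arctan_sum_pi_half)
  then show ?thesis
    using sum_out_arcs[OF a(1), of angle] unfolding a(2) by (simp add: angle_def x_def y_def z_def)
qed

section \<open>Sums over spheres and their limits\<close>

lemma angle_sphere:
  assumes "u \<in> verts G"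
  shows "(\<Sum>p\<in>sphere u (Suc n). angle (last p)) = pi"
  \<comment> \<open>Reversal and vertex sum involve the same constant \<open>pi\<close>, so the
    vertices contribute nothing.\<close>
  using telescope_sphere[OF assms, of angle pi "\<lambda>_. 0"] by (simp add: angle_vertex angle_arev)

lemma flux_sphere:
  assumes "u \<in> verts G"
  shows "(\<Sum>p\<in>sphere u (Suc n). flux (last p)) = (\<Sum>v\<in>ball_verts u n. \<bar>D\<bar> * inv_prod v)"
  unfolding sum_ball_verts[OF assms]
  using telescope_sphere[OF assms, of flux 0 "\<lambda>v. \<bar>D\<bar> * inv_prod v"]
  by (simp add: flux_vertex flux_arev)

lemma flux_sq_sphere:
  assumes "u \<in> verts G"
  shows "(\<Sum>p\<in>sphere u (Suc n). flux_sq (last p)) =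
    (\<Sum>v\<in>ball_verts u n. \<bar>D\<bar> * sum_inv_prod_sq v - 6 * inv_prod v)"
  unfolding sum_ball_verts[OF assms]
  using telescope_sphere[OF assms, of flux_sq 0 "\<lambda>v. \<bar>D\<bar> * sum_inv_prod_sq v - 6 * inv_prod v"]
  by (simp add: flux_sq_vertex flux_sq_arev)

lemma flux_angle:
  assumes a: "a \<in> arcs G" and m: "m > 0" "slope a \<ge> m"
  shows "root_disc * flux a \<le> 4 * angle a"
    and "4 / (1 + (root_disc / m)\<^sup>2) * angle a \<le> root_disc * flux a"
    and "0 \<le> flux_sq a"
    and "root_disc ^ 3 * flux_sq a \<le> 16 * (root_disc / m)\<^sup>2 * angle a"
proof -
  have "4 * (size_left a * size_left (arev a)) = (slope a)\<^sup>2 + root_disc\<^sup>2"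
    using slope_disc[OF a] by (simp add: abs_D)
  note bounds = flux_bounds[OF root_disc_pos m this, folded flux_def flux_sq_def angle_def]
  show "root_disc * flux a \<le> 4 * angle a"
    and "4 / (1 + (root_disc / m)\<^sup>2) * angle a \<le> root_disc * flux a"
    and "0 \<le> flux_sq a"
    and "root_disc ^ 3 * flux_sq a \<le> 16 * (root_disc / m)\<^sup>2 * angle a"
    by (fact bounds)+
qed

lemma inv_prod_nonneg: "inv_prod v \<ge> 0"
  by (simp add: inv_prod_def)

lemma sum_inv_prod_sq_nonneg: "sum_inv_prod_sq v \<ge> 0"
  by (simp add: sum_inv_prod_sq_def)

text \<open>The bounds of \<open>flux_angle\<close> with m = 2 n, positive for n > 0, are summed
  over a sphere of total angle pi. Both factors in the first pair of bounds are 4 in the limit; the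
  factor in the second upper bound tends to 0.\<close>

lemma
  assumes u: "u \<in> verts G" and valley: "\<And>a. a \<in> out_arcs G u \<Longrightarrow> slope a \<ge> 0"
  shows flux_sphere_lim:
      "(\<lambda>n. \<Sum>p\<in>sphere u (Suc n). root_disc * flux (last p)) \<longlonglongrightarrow> 4 * pi"
    and flux_sq_sphere_lim:
      "(\<lambda>n. \<Sum>p\<in>sphere u (Suc n). root_disc ^ 3 * flux_sq (last p)) \<longlonglongrightarrow> 0"
proof -
  have arc: "last p \<in> arcs G" "slope (last p) \<ge> 2 * real n" if "p \<in> sphere u (Suc n)" for p n
    using that sphere_last slope_sphere[OF u valley] by auto
  have ang: "c * pi = (\<Sum>p\<in>sphere u (Suc n). c * angle (last p))" for n c
    using angle_sphere[OF u] by (simp flip: sum_distrib_left)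
  note bound = flux_angle[OF arc(1) _ arc(2)]
  have up: "(\<Sum>p\<in>sphere u (Suc n). root_disc * flux (last p)) \<le> 4 * pi" if "n > 0" for n
    using that by (intro ord_le_eq_trans[OF sum_mono[OF bound(1)] ang[symmetric]]) auto
  have lo: "4 / (1 + (root_disc / (2 * real n))\<^sup>2) * pi \<le>
      (\<Sum>p\<in>sphere u (Suc n). root_disc * flux (last p))" if "n > 0" for n
    using that by (intro ord_eq_le_trans[OF ang sum_mono[OF bound(2)]]) auto
  have lim: "(\<lambda>n. root_disc / (2 * real n)) \<longlonglongrightarrow> 0"
    using tendsto_mult[OF tendsto_const[of "root_disc / 2"] lim_1_over_n] by simp
  have "(\<lambda>n. 4 / (1 + (root_disc / (2 * real n))\<^sup>2) * pi) \<longlonglongrightarrow> 4 / (1 + 0\<^sup>2) * pi"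
    by (intro tendsto_intros lim) auto
  then show "(\<lambda>n. \<Sum>p\<in>sphere u (Suc n). root_disc * flux (last p)) \<longlonglongrightarrow> 4 * pi"
    by (intro tendsto_sandwich[OF eventually_mono[OF eventually_gt_at_top[of 0] lo]
          eventually_mono[OF eventually_gt_at_top[of 0] up]]) auto
  have up2: "(\<Sum>p\<in>sphere u (Suc n). root_disc ^ 3 * flux_sq (last p)) \<le>
      16 * (root_disc / (2 * real n))\<^sup>2 * pi" if "n > 0" for n
    using that by (intro ord_le_eq_trans[OF sum_mono[OF bound(4)] ang[symmetric]]) auto
  have lo2: "0 \<le> (\<Sum>p\<in>sphere u (Suc n). root_disc ^ 3 * flux_sq (last p))" if "n > 0" for n
    using that root_disc_pos by (intro sum_nonneg mult_nonneg_nonneg bound(3)) auto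
  have "(\<lambda>n. 16 * (root_disc / (2 * real n))\<^sup>2 * pi) \<longlonglongrightarrow> 16 * 0\<^sup>2 * pi"
    by (intro tendsto_intros lim)
  then show "(\<lambda>n. \<Sum>p\<in>sphere u (Suc n). root_disc ^ 3 * flux_sq (last p)) \<longlonglongrightarrow> 0"
    by (intro tendsto_sandwich[OF eventually_mono[OF eventually_gt_at_top[of 0] lo2]
          eventually_mono[OF eventually_gt_at_top[of 0] up2]]) auto
qed

lemma root_disc_powers:
  "\<bar>real_of_int D\<bar> powr (3/2) = root_disc ^ 3" "\<bar>real_of_int D\<bar> powr (5/2) = root_disc ^ 5"
proof -
  have "\<bar>real_of_int D\<bar> powr (real k / 2) = root_disc ^ k" for k
    using root_disc_pos by (simp add: root_disc_def powr_half_sqrt[symmetric] powr_powr flip: powr_realpow)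
  from this[of 3] this[of 5] show
    "\<bar>real_of_int D\<bar> powr (3/2) = root_disc ^ 3" "\<bar>real_of_int D\<bar> powr (5/2) = root_disc ^ 5"
    by simp_all
qed

lemma has_sum_vertices:
  shows "(inv_prod has_sum 4 * pi / root_disc ^ 3) (verts G)"
    and "(sum_inv_prod_sq has_sum 24 * pi / root_disc ^ 5) (verts G)"
proof -
  obtain u where u: "u \<in> verts G" "\<And>a. a \<in> out_arcs G u \<Longrightarrow> slope a \<ge> 0"
    using valley_vertex by blast
  note q = root_disc_pos abs_D
  define P where "P n = (\<Sum>v\<in>ball_verts u n. inv_prod v)" for n
  define Q where "Q n = (\<Sum>v\<in>ball_verts u n. sum_inv_prod_sq v)" for n
  have "(\<Sum>p\<in>sphere u (Suc n). root_disc * flux (last p)) = root_disc ^ 3 * P n" for n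
    using flux_sphere[OF u(1), of n]
    by (simp add: P_def q(2) power3_eq_cube power2_eq_square mult.assoc flip: sum_distrib_left)
  then have "(\<lambda>n. root_disc ^ 3 * P n) \<longlonglongrightarrow> 4 * pi"
    using flux_sphere_lim[OF u] by simp
  from tendsto_divide[OF this tendsto_const[of "root_disc ^ 3"]]
  have P: "P \<longlonglongrightarrow> 4 * pi / root_disc ^ 3"
    using q(1) by simp
  have "(\<Sum>p\<in>sphere u (Suc n). root_disc ^ 3 * flux_sq (last p)) =
      root_disc ^ 5 * Q n - 6 * root_disc ^ 3 * P n" for n
  proof -
    have "(\<Sum>p\<in>sphere u (Suc n). root_disc ^ 3 * flux_sq (last p)) =
        root_disc ^ 3 * (root_disc\<^sup>2 * Q n - 6 * P n)"
      using flux_sq_sphere[OF u(1), of n]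
      by (simp add: P_def Q_def q(2) sum_subtractf flip: sum_distrib_left)
    then show ?thesis
      by (simp add: algebra_simps power_add[symmetric])
  qed
  then have "(\<lambda>n. root_disc ^ 5 * Q n - 6 * root_disc ^ 3 * P n) \<longlonglongrightarrow> 0"
    using flux_sq_sphere_lim[OF u] by simp
  \<comment> \<open>The boundary term vanishes, so the limit is 6 times that of
    \<open>root_disc ^ 3 * P n\<close>, that is 6 * 4 pi.\<close>
  from tendsto_add[OF this tendsto_mult[OF tendsto_const[of "6 * root_disc ^ 3"] P]]
  have "(\<lambda>n. root_disc ^ 5 * Q n) \<longlonglongrightarrow> 24 * pi"
    using q(1) by simp
  from tendsto_divide[OF this tendsto_const[of "root_disc ^ 5"]]
  have Q: "Q \<longlonglongrightarrow> 24 * pi / root_disc ^ 5"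
    using q(1) by simp
  note exhaust = has_sum_exhaustion[OF finite_ball_verts[OF u(1)] incseq_ball_verts UN_ball_verts[OF u(1)]]
  show "(inv_prod has_sum 4 * pi / root_disc ^ 3) (verts G)"
    using P unfolding P_def by (intro exhaust inv_prod_nonneg)
  show "(sum_inv_prod_sq has_sum 24 * pi / root_disc ^ 5) (verts G)"
    using Q unfolding Q_def by (intro exhaust sum_inv_prod_sq_nonneg)
qed

end

theorem theorem9p1:
  fixes G :: "('v, 'e) pre_digraph"
    and arev rot :: "'e \<Rightarrow> 'e"
    and lab :: "'e set \<Rightarrow> int"
    and D :: int
  assumes "topograph G arev rot lab"
    and "has_discriminant G arev rot lab D"
    and "D < 0"
  shows "(\<lambda>v. 1 / real_of_int \<bar>vertex_prod G arev rot lab v\<bar>) summable_on verts G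
    \<and> real_of_int \<bar>D\<bar> powr (3/2)
        * (\<Sum>\<^sub>\<infinity>v\<in>verts G. 1 / real_of_int \<bar>vertex_prod G arev rot lab v\<bar>) = 4 * pi
    \<and> (\<lambda>v. real_of_int \<bar>vertex_sum G arev rot lab v\<bar>
             / real_of_int \<bar>vertex_prod G arev rot lab v\<bar> ^ 2) summable_on verts G
    \<and> real_of_int \<bar>D\<bar> powr (5/2)
        * (\<Sum>\<^sub>\<infinity>v\<in>verts G. real_of_int \<bar>vertex_sum G arev rot lab v\<bar>
             / real_of_int \<bar>vertex_prod G arev rot lab v\<bar> ^ 2) = 24 * pi"
proof -
  interpret topograph G arev rot lab
    by fact
  interpret definite_topograph G arev rot lab D
    by unfold_locales fact+
  note sums = has_sum_vertices[unfolded inv_prod_def[abs_def] sum_inv_prod_sq_def[abs_def]]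
  show ?thesis
    using has_sum_imp_summable[OF sums(1)] has_sum_imp_summable[OF sums(2)]
      infsumI[OF sums(1)] infsumI[OF sums(2)] root_disc_pos root_disc_powers
    by simp
qed

end
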